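(* For 4-qubit CSX-states $$|\psi_X^{(4)}\rangle=a|0000\rangle+c\,\overbrace{|0011\rangle}+d\,\overbrace{|0101\rangle}+f|1111\rangle,\qquad a,c,d,f\in\mathbb{C},\ |a|^2+|c|^2+|d|^2+|f|^2=1,$$ the threshold of $s\mathcal{C}_1^{(4)}$ is $\frac{2\sqrt2-1}{4}$ and the threshold of $s\mathcal{C}_2^{(4)}$ is $\frac45$. That is: $\tau=\frac{2\sqrt2-1}{4}$ is the smallest real number such that every 4-qubit CSX-state with $s\mathcal{C}_1^{(4)}>\tau$ has $s\mathcal{C}_2^{(4)}<0$ (hence zero concurrence between opposite parties), and $\tau=\frac45$ is the smallest real number such that every 4-qubit CSX-state with $s\mathcal{C}_2^{(4)}>\tau$ has $s\mathcal{C}_1^{(4)}<0$ (hence zero concurrence between adjacent parties).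
   Context: For a bit string $i_1\dots i_n$, $\overbrace{|i_1 i_2\dots i_n\rangle}$ denotes the normalized equal-weight superposition of the distinct computational basis vectors obtained from $|i_1\dots i_n\rangle$ by cyclic permutations of the $n$ tensor factors. Thus $\overbrace{|0011\rangle}=\frac12(|0011\rangle+|1001\rangle+|1100\rangle+|0110\rangle)$ and $\overbrace{|0101\rangle}=\frac1{\sqrt2}(|0101\rangle+|1010\rangle)$. A CSX-state is a pure state invariant under cyclic permutations of the parties which is a superposition only of computational basis elements containing an even number of 1's; for 4 qubits these are exactly the states displayed in the claim. For a two-qubit density matrix $\rho$, the subconcurrence is $s\mathcal{C}(\rho)=\lambda_1-\lambda_2-\lambda_3-\lambda_4$, where $\lambda_1\ge\lambda_2\ge\lambda_3\ge\lambda_4$ are the square roots of the eigenvalues of $\rho\tilde\rho$, with $\tilde\rho=(\sigma_y\otimes\sigma_y)\rho^*(\sigma_y\otimes\sigma_y)$ and $\rho^*$ the entrywise complex conjugate in the computational basis; the (Wootters) concurrence is $\max\{0,s\mathcal{C}(\rho)\}$. For a cyclically symmetric 4-qubit state, $s\mathcal{C}_k^{(4)}$ ($k=1,2$) is the subconcurrence of the reduced density matrix of two parties whose labels differ by $k$ mod 4 (independent of the pair). The threshold of one of the two subconcurrences is the value above which the other subconcurrence must be negative. *)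

theory Defs
  imports "HOL-Analysis.Analysis" "HOL-Computational_Algebra.Fundamental_Theorem_Algebra"
begin

text \<open>
  The parties are the elements of the numeral type \<open>4\<close>, i.e. 0, 1, 2, 3 with arithmetic modulo 4;
  bits are the elements 0, 1 of the numeral type \<open>2\<close>. A bit string is a function from parties to
  bits, and a 4-qubit vector is a complex vector indexed by bit strings.
  Note that \<open>2 = 0\<close> in type \<open>2\<close> and \<open>4 = 0\<close> in type \<open>4\<close>.
\<close>

type_synonym bitstring = "4 \<Rightarrow> 2"
type_synonym state4 = "complex ^ bitstring"

definition bits :: "2 \<Rightarrow> 2 \<Rightarrow> 2 \<Rightarrow> 2 \<Rightarrow> bitstring" where
  "bits i j k l = (\<lambda>p. if p = 0 then i else if p = 1 then j else if p = 2 then k else l)"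

definition ket :: "bitstring \<Rightarrow> state4" where
  "ket s = axis s 1"

definition rotate_bits :: "4 \<Rightarrow> bitstring \<Rightarrow> bitstring" where
  "rotate_bits k s = (\<lambda>p. s (p + k))"

definition cyclic_orbit :: "bitstring \<Rightarrow> bitstring set" where
  "cyclic_orbit s = range (\<lambda>k. rotate_bits k s)"

definition cyclic_ket :: "bitstring \<Rightarrow> state4" where
  "cyclic_ket s = (1 / sqrt (card (cyclic_orbit s))) *\<^sub>R (\<Sum>t\<in>cyclic_orbit s. ket t)"

definition cyclically_symmetric :: "state4 \<Rightarrow> bool" where
  "cyclically_symmetric \<psi> \<longleftrightarrow> (\<forall>k s. \<psi> $ rotate_bits k s = \<psi> $ s)"

definition csx_state :: "state4 \<Rightarrow> bool" where
  "csx_state \<psi> \<longleftrightarrow> norm \<psi> = 1 \<and> cyclically_symmetric \<psi> \<and>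
     (\<forall>s. odd (card {p. s p = 1}) \<longrightarrow> \<psi> $ s = 0)"

type_synonym two_qubit_mat = "complex ^ (2 \<times> 2) ^ (2 \<times> 2)"

definition density :: "state4 \<Rightarrow> complex ^ bitstring ^ bitstring" where
  "density \<psi> = (\<chi> s t. \<psi> $ s * cnj (\<psi> $ t))"

text \<open>Partial trace over all parties other than \<open>p \<noteq> q\<close>: sum the entries whose row and column
  strings restrict to \<open>u\<close> and \<open>v\<close> on \<open>(p, q)\<close> and agree on all the other parties.\<close>

definition reduced :: "4 \<Rightarrow> 4 \<Rightarrow> complex ^ bitstring ^ bitstring \<Rightarrow> two_qubit_mat" where
  "reduced p q R = (\<chi> u v. \<Sum>(s, t) | (s p, s q) = u \<and> (t p, t q) = v \<and>
     (\<forall>r. r \<noteq> p \<and> r \<noteq> q \<longrightarrow> s r = t r). R $ s $ t)"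

definition sigma_y :: "complex ^ 2 ^ 2" where
  "sigma_y = (\<chi> i j. if i = 0 \<and> j = 1 then - \<i> else if i = 1 \<and> j = 0 then \<i> else 0)"

definition kron :: "complex ^ 2 ^ 2 \<Rightarrow> complex ^ 2 ^ 2 \<Rightarrow> two_qubit_mat" where
  "kron A B = (\<chi> u v. A $ fst u $ fst v * B $ snd u $ snd v)"

definition spin_flip :: "two_qubit_mat \<Rightarrow> two_qubit_mat" where
  "spin_flip R = kron sigma_y sigma_y ** (\<chi> u v. cnj (R $ u $ v)) ** kron sigma_y sigma_y"

definition charpoly :: "'a::comm_ring_1 ^ 'n ^ 'n \<Rightarrow> 'a poly" where
  "charpoly A = det (\<chi> i j. (if i = j then [:0, 1:] else 0) - [:A $ i $ j:])"

text \<open>Square roots of the eigenvalues of \<open>R ** spin_flip R\<close>, with algebraic multiplicity and in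
  decreasing order. For a density matrix \<open>R\<close> these eigenvalues are real and nonnegative, so
  taking the real part only serves to convert them to type \<open>real\<close>.\<close>

definition wootters_values :: "two_qubit_mat \<Rightarrow> real list" where
  "wootters_values R = rev (sorted_list_of_multiset
     (image_mset (\<lambda>z. sqrt (Re z)) (proots (charpoly (R ** spin_flip R)))))"

definition subconcurrence :: "two_qubit_mat \<Rightarrow> real" where
  "subconcurrence R =
     (let l = wootters_values R in l ! 0 - l ! 1 - l ! 2 - l ! 3)"

definition concurrence :: "two_qubit_mat \<Rightarrow> real" where
  "concurrence R = max 0 (subconcurrence R)"

text \<open>The subconcurrence of two parties at distance \<open>k\<close>, computed for the pair \<open>(0, k)\<close>; the lemma
  \<open>reduced_rotate\<close> below shows that the pair is irrelevant for cyclically symmetric states.\<close>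

definition subconcurrence_dist :: "4 \<Rightarrow> state4 \<Rightarrow> real" where
  "subconcurrence_dist k \<psi> = subconcurrence (reduced 0 k (density \<psi>))"

definition is_threshold ::
  "state4 set \<Rightarrow> (state4 \<Rightarrow> real) \<Rightarrow> (state4 \<Rightarrow> real) \<Rightarrow> real \<Rightarrow> bool" where
  "is_threshold S F G \<tau> \<longleftrightarrow>
     (\<forall>\<psi>\<in>S. F \<psi> > \<tau> \<longrightarrow> G \<psi> < 0) \<and>
     (\<forall>\<tau>'. (\<forall>\<psi>\<in>S. F \<psi> > \<tau>' \<longrightarrow> G \<psi> < 0) \<longrightarrow> \<tau> \<le> \<tau>')"

lemma concurrence_eq_0: "subconcurrence R < 0 \<Longrightarrow> concurrence R = 0"
  by (simp add: concurrence_def)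

lemma reduced_rotate:
  assumes "cyclically_symmetric \<psi>"
  shows "reduced (p + m) (q + m) (density \<psi>) = reduced p q (density \<psi>)"
proof -
  have inv: "\<psi> $ rotate_bits k s = \<psi> $ s" for k s
    using assms by (simp add: cyclically_symmetric_def)
  have rr: "rotate_bits k (rotate_bits (- k) s) = s" "rotate_bits (- k) (rotate_bits k s) = s" for k s
    by (simp_all add: rotate_bits_def)
  let ?h = "\<lambda>k (s, t). (rotate_bits k s, rotate_bits k t)"
  have sh: "(\<forall>r. r \<noteq> p + m \<and> r \<noteq> q + m \<longrightarrow> P r) \<longleftrightarrow> (\<forall>r. r \<noteq> p \<and> r \<noteq> q \<longrightarrow> P (r + m))" for P
    by (metis add_right_cancel diff_add_cancel)
  have "(\<Sum>(s, t) | (s (p + m), s (q + m)) = u \<and> (t (p + m), t (q + m)) = v \<and>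
     (\<forall>r. r \<noteq> p + m \<and> r \<noteq> q + m \<longrightarrow> s r = t r). \<psi> $ s * cnj (\<psi> $ t)) =
     (\<Sum>(s, t) | (s p, s q) = u \<and> (t p, t q) = v \<and>
     (\<forall>r. r \<noteq> p \<and> r \<noteq> q \<longrightarrow> s r = t r). \<psi> $ s * cnj (\<psi> $ t))" for u v
    by (rule sum.reindex_bij_witness[where i = "?h (- m)" and j = "?h m"])
      (auto simp: rr inv sh, auto simp: rotate_bits_def sh)
  then show ?thesis
    by (simp add: reduced_def density_def)
qed

lemma bit_cases: "(b::2) = 0 \<or> b = 1"
  using exhaust_2[of b] by auto

lemma party_cases: "(p::4) = 0 \<or> p = 1 \<or> p = 2 \<or> p = 3"
  using exhaust_4[of p] by auto

lemma party_wrap: "(4::4) = 0" "(5::4) = 1" "(6::4) = 2"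
  by simp_all

lemma UNIV_party: "(UNIV :: 4 set) = {0, 1, 2, 3}"
  using party_cases by auto

lemma bits_apply [simp]:
  "bits i j k l 0 = i" "bits i j k l 1 = j" "bits i j k l 2 = k" "bits i j k l 3 = l"
  by (simp_all add: bits_def)

lemma bits_eq_iff [simp]:
  "bits i j k l = bits i' j' k' l' \<longleftrightarrow> i = i' \<and> j = j' \<and> k = k' \<and> l = l'"
proof
  assume "bits i j k l = bits i' j' k' l'"
  then have "bits i j k l p = bits i' j' k' l' p" for p by simp
  from this[of 0] this[of 1] this[of 2] this[of 3]
  show "i = i' \<and> j = j' \<and> k = k' \<and> l = l'" by simp
qed simp

lemma bits_collapse: "bits (s 0) (s 1) (s 2) (s 3) = s"
proof
  fix p show "bits (s 0) (s 1) (s 2) (s 3) p = s p"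
    using party_cases[of p] by auto
qed

lemma rotate_bits_bits [simp]:
  "rotate_bits 0 (bits i j k l) = bits i j k l"
  "rotate_bits 1 (bits i j k l) = bits j k l i"
  "rotate_bits 2 (bits i j k l) = bits k l i j"
  "rotate_bits 3 (bits i j k l) = bits l i j k"
  using bits_collapse[of "rotate_bits 0 (bits i j k l)"] bits_collapse[of "rotate_bits 1 (bits i j k l)"]
    bits_collapse[of "rotate_bits 2 (bits i j k l)"] bits_collapse[of "rotate_bits 3 (bits i j k l)"]
  by (simp_all add: rotate_bits_def party_wrap)

lemma cyclic_orbit_bits:
  "cyclic_orbit (bits i j k l) = {bits i j k l, bits j k l i, bits k l i j, bits l i j k}"
  by (simp add: cyclic_orbit_def UNIV_party)

lemma cyclic_ket_0011:
  "cyclic_ket (bits 0 0 1 1) =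
     (1 / 2) *\<^sub>R (ket (bits 0 0 1 1) + ket (bits 1 0 0 1) + ket (bits 1 1 0 0) + ket (bits 0 1 1 0))"
  by (simp add: cyclic_ket_def cyclic_orbit_bits algebra_simps)

lemma cyclic_ket_0101:
  "cyclic_ket (bits 0 1 0 1) = (1 / sqrt 2) *\<^sub>R (ket (bits 0 1 0 1) + ket (bits 1 0 1 0))"
proof -
  have "cyclic_orbit (bits 0 1 0 1) = {bits 0 1 0 1, bits 1 0 1 0}"
    by (auto simp: cyclic_orbit_bits)
  then show ?thesis
    by (simp add: cyclic_ket_def)
qed

lemma odd_weight_bits:
  "odd (card {p. bits i j k l p = 1}) \<longleftrightarrow> odd (of_bool (i = 1) + of_bool (j = 1) + of_bool (k = 1) + of_bool (l = 1) :: nat)"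
proof -
  have "card {p. bits i j k l p = 1} = (\<Sum>p\<in>UNIV. of_bool (bits i j k l p = 1))"
    by simp
  also have "\<dots> = of_bool (i = 1) + of_bool (j = 1) + of_bool (k = 1) + of_bool (l = 1)"
    unfolding UNIV_party by simp
  finally show ?thesis by simp
qed

lemma sum_bits: "(\<Sum>s\<in>UNIV. f s) = (\<Sum>(i, j, k, l)\<in>UNIV. f (bits i j k l))"
  by (rule sum.reindex_bij_witness[where j = "\<lambda>s. (s 0, s 1, s 2, s 3)" and i = "\<lambda>(i, j, k, l). bits i j k l"])
    (auto simp: bits_collapse)

lemma all_bits: "(\<forall>s :: bitstring. P s) \<longleftrightarrow> (\<forall>i j k l. P (bits i j k l))"
proof (intro iffI allI)
  fix s :: bitstring
  assume "\<forall>i j k l. P (bits i j k l)"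
  then have "P (bits (s 0) (s 1) (s 2) (s 3))" by blast
  then show "P s" unfolding bits_collapse .
qed simp

lemma all_bit: "(\<forall>b::2. P b) \<longleftrightarrow> P 0 \<and> P 1"
  using bit_cases by (auto, metis)

lemma all_party: "(\<forall>p::4. P p) \<longleftrightarrow> P 0 \<and> P 1 \<and> P 2 \<and> P 3"
  using party_cases by (auto, metis)

lemma ket_bits_nth [simp]: "ket (bits i j k l) $ bits i' j' k' l' =
   (if i = i' \<and> j = j' \<and> k = k' \<and> l = l' then 1 else 0)"
  by (simp add: ket_def axis_def)

lemma sum_bit: "(\<Sum>b\<in>UNIV. f (b::2)) = f 0 + f 1"
proof -
  have U: "UNIV = {0, 1::2}" using bit_cases by auto
  show ?thesis unfolding U by simp
qed

lemma norm_sq: "(norm (\<psi> :: state4))\<^sup>2 = (\<Sum>s\<in>UNIV. (cmod (\<psi> $ s))\<^sup>2)"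
  by (simp add: norm_vec_def L2_set_def sum_nonneg)

lemma csx_states_eq:
  "{\<psi>. csx_state \<psi>} =
     {a *s ket (bits 0 0 0 0) + c *s cyclic_ket (bits 0 0 1 1)
        + d *s cyclic_ket (bits 0 1 0 1) + f *s ket (bits 1 1 1 1) | a c d f.
      (cmod a)\<^sup>2 + (cmod c)\<^sup>2 + (cmod d)\<^sup>2 + (cmod f)\<^sup>2 = 1}" (is "_ = {?psi a c d f | a c d f. _}")
proof -
  have norm1: "norm \<psi> = 1 \<longleftrightarrow> (norm \<psi>)\<^sup>2 = 1" for \<psi> :: state4
    by (simp add: power2_eq_1_iff) (smt (verit) norm_ge_zero)
  have norm_psi: "(norm (?psi a c d f))\<^sup>2 = (cmod a)\<^sup>2 + (cmod c)\<^sup>2 + (cmod d)\<^sup>2 + (cmod f)\<^sup>2" for a c d f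
    unfolding norm_sq sum_bits UNIV_Times_UNIV[symmetric] sum.cartesian_product[symmetric]
    by (simp add: sum_bit cyclic_ket_0011 cyclic_ket_0101 norm_divide norm_mult power_divide)
  have shape: "cyclically_symmetric \<psi> \<and> (\<forall>s. odd (card {p. s p = 1}) \<longrightarrow> \<psi> $ s = 0) \<longleftrightarrow>
      (\<exists>a c d f. \<psi> = ?psi a c d f)" for \<psi>
  proof
    assume A: "cyclically_symmetric \<psi> \<and> (\<forall>s. odd (card {p. s p = 1}) \<longrightarrow> \<psi> $ s = 0)"
    have rot: "\<psi> $ rotate_bits k s = \<psi> $ s" for k s
      using A by (simp add: cyclically_symmetric_def)
    have cyc: "\<psi> $ bits 0 1 1 0 = \<psi> $ bits 0 0 1 1" "\<psi> $ bits 1 1 0 0 = \<psi> $ bits 0 0 1 1"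
      "\<psi> $ bits 1 0 0 1 = \<psi> $ bits 0 0 1 1" "\<psi> $ bits 1 0 1 0 = \<psi> $ bits 0 1 0 1"
      using rot[of 1 "bits 0 0 1 1"] rot[of 2 "bits 0 0 1 1"] rot[of 3 "bits 0 0 1 1"]
        rot[of 1 "bits 0 1 0 1"] by simp_all
    have odd0: "\<psi> $ bits i j k l = 0"
      if "odd (of_bool (i = 1) + of_bool (j = 1) + of_bool (k = 1) + of_bool (l = 1) :: nat)" for i j k l
      using A that odd_weight_bits by blast
    have "\<psi> = ?psi (\<psi> $ bits 0 0 0 0) (2 * \<psi> $ bits 0 0 1 1) (sqrt 2 * \<psi> $ bits 0 1 0 1) (\<psi> $ bits 1 1 1 1)"
      by (simp add: vec_eq_iff all_bits all_bit odd0 cyc cyclic_ket_0011 cyclic_ket_0101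
        scaleR_conv_of_real[where 'a = complex])
    then show "\<exists>a c d f. \<psi> = ?psi a c d f" by blast
  next
    assume "\<exists>a c d f. \<psi> = ?psi a c d f"
    then show "cyclically_symmetric \<psi> \<and> (\<forall>s. odd (card {p. s p = 1}) \<longrightarrow> \<psi> $ s = 0)"
      by (elim exE) (simp add: cyclically_symmetric_def all_party all_bits odd_weight_bits all_bit
        cyclic_ket_0011 cyclic_ket_0101)
  qed
  show ?thesis
  proof (intro set_eqI)
    fix \<psi>
    have "csx_state \<psi> \<longleftrightarrow> norm \<psi> = 1 \<and> (\<exists>a c d f. \<psi> = ?psi a c d f)"
      unfolding csx_state_def shape ..
    also have "\<dots> \<longleftrightarrow> (\<exists>a c d f. \<psi> = ?psi a c d f \<and>
        (cmod a)\<^sup>2 + (cmod c)\<^sup>2 + (cmod d)\<^sup>2 + (cmod f)\<^sup>2 = 1)"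
    proof -
      have "norm \<psi> = 1 \<longleftrightarrow> (cmod a)\<^sup>2 + (cmod c)\<^sup>2 + (cmod d)\<^sup>2 + (cmod f)\<^sup>2 = 1"
        if "\<psi> = ?psi a c d f" for a c d f
        unfolding norm1 that norm_psi ..
      then show ?thesis by blast
    qed
    finally show "\<psi> \<in> {\<psi>. csx_state \<psi>} \<longleftrightarrow> \<psi> \<in> {?psi a c d f | a c d f.
        (cmod a)\<^sup>2 + (cmod c)\<^sup>2 + (cmod d)\<^sup>2 + (cmod f)\<^sup>2 = 1}"
      by blast
  qed
qed

end

theory Submission
  imports Defs
begin

text \<open>
  With $x = c/2$ and $y = d/\sqrt 2$ the amplitudes of the non-constant bit strings, both two-party
  reductions are X-shaped: they preserve the parity of the two bits. For such a matrix
  $\rho\tilde\rho$ splits into two $2 \times 2$ blocks, and the subconcurrence is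
  $2\max(|w| - \sqrt{rs}, |z| - \sqrt{pq})$, where $p, q, w$ and $r, s, z$ are the diagonal and
  off-diagonal entries of the even and the odd block. By the triangle inequality the phases of
  $a, c, d, f$ may be dropped, which leaves inequalities in the four moduli. Typically, on a branch
  of the maxima, $\tau$ times the normalisation form, minus the quantity to be bounded, minus a multiple of
  the constraint, is a positive semidefinite quadratic form. The thresholds are attained at
  $(a,c,d,f) = (1/2, 1/\sqrt 2, 0, 1/2)$ and $(1/\sqrt 5, 2/\sqrt 5, 0, 0)$, where the other
  subconcurrence vanishes.
\<close>

section \<open>Spectrum of X-shaped two-qubit matrices\<close>

lemma UNIV_bit_pair: "(UNIV :: (2 \<times> 2) set) = {(0, 0), (1, 1), (0, 1), (1, 0)}"
  using bit_cases by auto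

text \<open>Sums in type \<open>2\<close> are parities, so in the basis order 00, 11, 01, 10 the
  matrix is block diagonal. The Leibniz sum is expanded one index at a time in that order.\<close>

lemma det_parity_blocks:
  fixes M :: "'a::comm_ring_1 ^ (2 \<times> 2) ^ (2 \<times> 2)"
  assumes "\<And>i j k l. i + j \<noteq> k + l \<Longrightarrow> M $ (i, j) $ (k, l) = 0"
  shows "det M =
    (M $ (0,0) $ (0,0) * M $ (1,1) $ (1,1) - M $ (0,0) $ (1,1) * M $ (1,1) $ (0,0)) *
    (M $ (0,1) $ (0,1) * M $ (1,0) $ (1,0) - M $ (0,1) $ (1,0) * M $ (1,0) $ (0,1))"
proof -
  have fin: "finite {(1,1), (0,1), (1,0) :: 2 \<times> 2}" "finite {(0,1), (1,0) :: 2 \<times> 2}"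
      "finite {(1,0) :: 2 \<times> 2}"
    and notin: "(0,0) \<notin> {(1,1), (0,1), (1,0) :: 2 \<times> 2}" "(1,1) \<notin> {(0,1), (1,0) :: 2 \<times> 2}"
      "(0,1) \<notin> {(1,0) :: 2 \<times> 2}"
    by auto
  have zero: "M $ (0,0) $ (0,1) = 0" "M $ (0,0) $ (1,0) = 0" "M $ (1,1) $ (0,1) = 0" "M $ (1,1) $ (1,0) = 0"
    "M $ (0,1) $ (0,0) = 0" "M $ (1,0) $ (0,0) = 0" "M $ (0,1) $ (1,1) = 0" "M $ (1,0) $ (1,1) = 0"
    by (rule assms, simp)+
  show ?thesis
    unfolding det_def UNIV_bit_pair
    unfolding sum_over_permutations_insert[OF fin(1) notin(1)]
    unfolding sum_over_permutations_insert[OF fin(2) notin(2)]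
    unfolding sum_over_permutations_insert[OF fin(3) notin(3)]
    unfolding permutes_sing
    by (simp add: zero sign_swap_id permutation_swap_id sign_compose sign_id permutation_compose
        transpose_def algebra_simps)
qed

text \<open>The general Hermitian matrix preserving the parity of the two bits; a density matrix of
  this shape is known as an X-state.\<close>

definition x_matrix :: "real \<Rightarrow> real \<Rightarrow> complex \<Rightarrow> real \<Rightarrow> real \<Rightarrow> complex \<Rightarrow> two_qubit_mat" where
  "x_matrix p q w r s z = (\<chi> u v.
     if u = v then of_real (if u = (0, 0) then p else if u = (1, 1) then q else if u = (0, 1) then r else s)
     else if u = (0, 0) \<and> v = (1, 1) then w else if u = (1, 1) \<and> v = (0, 0) then cnj w
     else if u = (0, 1) \<and> v = (1, 0) then z else if u = (1, 0) \<and> v = (0, 1) then cnj z else 0)"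

lemma sum_bit_pair: "(\<Sum>u\<in>UNIV. g (u :: 2 \<times> 2)) = g (0, 0) + g (1, 1) + g (0, 1) + g (1, 0)"
  unfolding UNIV_bit_pair by (simp add: add.assoc)

text \<open>The spin flip swaps \<open>p\<close> with \<open>q\<close> and \<open>r\<close> with
  \<open>s\<close> and keeps \<open>w\<close> and \<open>z\<close>. The even block of the product
  thus has both diagonal entries \<open>p * q + w * cnj w\<close> and off-diagonal product
  \<open>4 * p * q * w * cnj w\<close>, so its characteristic polynomial is a difference of squares;
  likewise for the odd block.\<close>

lemma charpoly_x_matrix:
  assumes "p \<ge> 0" "q \<ge> 0" "r \<ge> 0" "s \<ge> 0"
  defines "P \<equiv> sqrt (p * q)" and "R \<equiv> sqrt (r * s)"
  shows "charpoly (x_matrix p q w r s z ** spin_flip (x_matrix p q w r s z)) =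
    [:- of_real ((P + cmod w)\<^sup>2), 1:] * [:- of_real ((P - cmod w)\<^sup>2), 1:] *
    ([:- of_real ((R + cmod z)\<^sup>2), 1:] * [:- of_real ((R - cmod z)\<^sup>2), 1:])"
proof -
  let ?M = "x_matrix p q w r s z ** spin_flip (x_matrix p q w r s z)"
  have flip: "spin_flip (x_matrix p q w r s z) = x_matrix q p w s r z"
    by (simp add: spin_flip_def x_matrix_def kron_def sigma_y_def matrix_matrix_mult_def vec_eq_iff
        sum_bit_pair all_bit)
  have M: "?M $ (0,0) $ (0,0) = of_real (p * q) + w * cnj w" "?M $ (1,1) $ (1,1) = of_real (p * q) + w * cnj w"
     "?M $ (0,0) $ (1,1) = of_real (2 * p) * w" "?M $ (1,1) $ (0,0) = of_real (2 * q) * cnj w"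
     "?M $ (0,1) $ (0,1) = of_real (r * s) + z * cnj z" "?M $ (1,0) $ (1,0) = of_real (r * s) + z * cnj z"
     "?M $ (0,1) $ (1,0) = of_real (2 * r) * z" "?M $ (1,0) $ (0,1) = of_real (2 * s) * cnj z"
    unfolding flip by (simp_all add: x_matrix_def matrix_matrix_mult_def sum_bit_pair)
  have off: "?M $ (i, j) $ (k, l) = 0" if "i + j \<noteq> k + l" for i j k l
    using that bit_cases[of i] bit_cases[of j] bit_cases[of k] bit_cases[of l]
    unfolding flip by (auto simp: x_matrix_def matrix_matrix_mult_def sum_bit_pair)
  have block: "[:- (of_real (a * b) + v * cnj v), 1:] * [:- (of_real (a * b) + v * cnj v), 1:]
        - [:- (of_real (2 * a) * v):] * [:- (of_real (2 * b) * cnj v):]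
      = [:- of_real ((sqrt (a * b) + cmod v)\<^sup>2), 1:] * [:- of_real ((sqrt (a * b) - cmod v)\<^sup>2), 1:]"
    if "a \<ge> 0" "b \<ge> 0" for a b :: real and v
  proof -
    define t where "t = sqrt (a * b)"
    have t: "t \<ge> 0" using that by (simp add: t_def)
    have ab: "a * b = t\<^sup>2" using that by (simp add: t_def)
    have vv: "v * cnj v = of_real ((cmod v)\<^sup>2)" by (metis complex_norm_square)
    have prod: "(of_real (2 * a) * v) * (of_real (2 * b) * cnj v) = (of_real (4 * t\<^sup>2 * (cmod v)\<^sup>2) :: complex)"
      unfolding ab[symmetric] of_real_mult vv[symmetric] by (simp add: ac_simps)
    show ?thesis
      unfolding t_def[symmetric] ab vv using prod
      by (simp add: power2_eq_square t algebra_simps)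
  qed
  show ?thesis
    unfolding charpoly_def P_def R_def
    by (subst det_parity_blocks) (use block[OF assms(1,2), of w] block[OF assms(3,4), of z] in \<open>auto simp: M off\<close>)
qed

lemma proots_linear_product:
  fixes e1 :: "'a::idom"
  shows "proots ([:- e1, 1:] * [:- e2, 1:] * ([:- e3, 1:] * [:- e4, 1:])) = {#e1, e2, e3, e4#}"
  by (subst proots_mult, simp, simp)+ simp

text \<open>The difference is twice the head minus the sum; the head is the maximum and the sum is
  symmetric, so the sorting disappears.\<close>

lemma sorted_four:
  fixes v1 v2 v3 v4 :: real
  defines "l \<equiv> rev (sorted_list_of_multiset {#v1, v2, v3, v4#})"
  shows "l ! 0 - l ! 1 - l ! 2 - l ! 3 = 2 * max (max v1 v2) (max v3 v4) - (v1 + v2 + v3 + v4)"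
proof -
  have m: "mset l = {#v1, v2, v3, v4#}" by (simp add: l_def)
  have "length l = size (mset l)" by simp
  also have "\<dots> = 4" unfolding m by simp
  finally obtain x0 x1 x2 x3 where l: "l = [x0, x1, x2, x3]"
    by (auto simp: length_Suc_conv numeral_eq_Suc)
  have "sorted (rev l)" by (simp add: l_def)
  then have ge: "x3 \<le> x2" "x2 \<le> x1" "x1 \<le> x0" by (auto simp: l)
  have "sum_mset (mset l) = v1 + (v2 + (v3 + v4))" unfolding m by simp
  then have s: "x0 + x1 + x2 + x3 = v1 + v2 + v3 + v4" by (simp add: l)
  have "set_mset (mset l) = {v1, v2, v3, v4}" unfolding m by simp
  then have S: "{x0, x1, x2, x3} = {v1, v2, v3, v4}" by (simp add: l)
  have "x0 = Max {x0, x1, x2, x3}" using ge by (simp)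
  also have "\<dots> = max (max v1 v2) (max v3 v4)" unfolding S by (simp add: max.assoc)
  finally show ?thesis using s by (simp add: l)
qed

text \<open>The bounds on \<open>w\<close> and \<open>z\<close> are positivity of the two blocks;
  they allow the square roots of the eigenvalues to be taken without absolute values. The four roots
  then sum to \<open>2 * (sqrt (p * q) + sqrt (r * s))\<close>.\<close>

lemma subconcurrence_x_matrix:
  assumes "p \<ge> 0" "q \<ge> 0" "r \<ge> 0" "s \<ge> 0" "cmod w \<le> sqrt (p * q)" "cmod z \<le> sqrt (r * s)"
  shows "subconcurrence (x_matrix p q w r s z) = 2 * max (cmod w - sqrt (r * s)) (cmod z - sqrt (p * q))"
proof -
  have "wootters_values (x_matrix p q w r s z) = rev (sorted_list_of_multiset
      {#sqrt (p * q) + cmod w, sqrt (p * q) - cmod w, sqrt (r * s) + cmod z, sqrt (r * s) - cmod z#})"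
    using assms unfolding wootters_values_def charpoly_x_matrix[OF assms(1-4)] proots_linear_product
    by (simp flip: of_real_power)
  then show ?thesis
    using norm_ge_zero[of w] norm_ge_zero[of z]
    by (simp only: subconcurrence_def Let_def sorted_four) (auto simp: max_def)
qed

section \<open>Two-party reductions of CSX-states\<close>

lemma reduced_adjacent:
  "reduced 0 1 R $ (i, j) $ (i', j') = (\<Sum>k\<in>UNIV. \<Sum>l\<in>UNIV. R $ bits i j k l $ bits i' j' k l)"
proof -
  have "(\<Sum>(s, t) | (s 0, s 1) = (i, j) \<and> (t 0, t 1) = (i', j') \<and>
     (\<forall>r. r \<noteq> 0 \<and> r \<noteq> 1 \<longrightarrow> s r = t r). R $ s $ t) = (\<Sum>(k, l)\<in>UNIV. R $ bits i j k l $ bits i' j' k l)"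
    by (rule sum.reindex_bij_witness[where i = "\<lambda>(k, l). (bits i j k l, bits i' j' k l)"
          and j = "\<lambda>(s, t). (s 2, s 3)"])
      (auto simp: all_party fun_eq_iff, metis bits_collapse)
  then show ?thesis
    by (simp add: reduced_def sum.cartesian_product)
qed

lemma reduced_opposite:
  "reduced 0 2 R $ (i, k) $ (i', k') = (\<Sum>j\<in>UNIV. \<Sum>l\<in>UNIV. R $ bits i j k l $ bits i' j k' l)"
proof -
  have "(\<Sum>(s, t) | (s 0, s 2) = (i, k) \<and> (t 0, t 2) = (i', k') \<and>
     (\<forall>r. r \<noteq> 0 \<and> r \<noteq> 2 \<longrightarrow> s r = t r). R $ s $ t) = (\<Sum>(j, l)\<in>UNIV. R $ bits i j k l $ bits i' j k' l)"
    by (rule sum.reindex_bij_witness[where i = "\<lambda>(j, l). (bits i j k l, bits i' j k' l)"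
          and j = "\<lambda>(s, t). (s 1, s 3)"])
      (auto simp: all_party fun_eq_iff, metis bits_collapse)
  then show ?thesis
    by (simp add: reduced_def sum.cartesian_product)
qed

definition csx :: "complex \<Rightarrow> complex \<Rightarrow> complex \<Rightarrow> complex \<Rightarrow> state4" where
  "csx a c d f = a *s ket (bits 0 0 0 0) + c *s cyclic_ket (bits 0 0 1 1)
     + d *s cyclic_ket (bits 0 1 0 1) + f *s ket (bits 1 1 1 1)"

text \<open>The factors \<open>2\<close> and \<open>sqrt 2\<close> cancel the normalisation of the
  cyclic kets. Addition of bits is in type \<open>2\<close>, so the first test is for odd weight;
  for even weight the first three bits determine \<open>l\<close>.\<close>

lemma csx_nth:
  fixes x y :: complex
  shows "csx a (2 * x) (sqrt 2 * y) f $ bits i j k l =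
    (if i + j + k + l \<noteq> 0 then 0
     else if i = j \<and> j = k then (if i = 0 then a else f)
     else if i = k then y else x)"
  using bit_cases[of i] bit_cases[of j] bit_cases[of k] bit_cases[of l]
  by (elim disjE) (simp_all add: csx_def cyclic_ket_0011 cyclic_ket_0101 scaleR_conv_of_real[where 'a = complex])

text \<open>Even total weight forces the kept and the traced pair to have equal parity, whence the X
  shape. Over the traced pairs 00, 11 the amplitudes are (a, x) at kept 00 and (x, f) at kept 11;
  over 01, 10 they are (y, x) at kept 01 and (x, y) at kept 10.\<close>

lemma reduced_csx_adjacent:
  fixes a c d f :: complex
  defines "x \<equiv> c / 2" and "y \<equiv> d / sqrt 2"
  shows "reduced 0 1 (density (csx a c d f)) =
    x_matrix ((cmod a)\<^sup>2 + (cmod x)\<^sup>2) ((cmod x)\<^sup>2 + (cmod f)\<^sup>2) (a * cnj x + x * cnj f)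
      ((cmod x)\<^sup>2 + (cmod y)\<^sup>2) ((cmod x)\<^sup>2 + (cmod y)\<^sup>2) (y * cnj x + x * cnj y)"
proof -
  have c: "c = 2 * x" and d: "d = sqrt 2 * y"
    by (simp_all add: x_def y_def)
  show ?thesis
    unfolding c d
    by (simp add: vec_eq_iff all_bit split_paired_all reduced_adjacent density_def csx_nth sum_bit x_matrix_def
      complex_norm_square add.commute
      del: of_real_power)
qed

text \<open>The even-weight strings in which parties 0 and 2 differ are exactly the rotations of
  0011, so all four entries of the odd block coincide.\<close>

lemma reduced_csx_opposite:
  fixes a c d f :: complex
  defines "x \<equiv> c / 2" and "y \<equiv> d / sqrt 2"
  shows "reduced 0 2 (density (csx a c d f)) =
    x_matrix ((cmod a)\<^sup>2 + (cmod y)\<^sup>2) ((cmod y)\<^sup>2 + (cmod f)\<^sup>2) (a * cnj y + y * cnj f)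
      (2 * (cmod x)\<^sup>2) (2 * (cmod x)\<^sup>2) (of_real (2 * (cmod x)\<^sup>2))"
proof -
  have c: "c = 2 * x" and d: "d = sqrt 2 * y"
    by (simp_all add: x_def y_def)
  show ?thesis
    unfolding c d
    by (simp add: vec_eq_iff all_bit split_paired_all reduced_opposite density_def csx_nth sum_bit x_matrix_def
      complex_norm_square add.commute
      del: of_real_power)
qed

text \<open>Supplies the positivity bounds on the off-diagonal entries of the reduced matrices, by
  Lagrange's identity for the moduli.\<close>

lemma cmod_cauchy_schwarz:
  "cmod (a * cnj b + c * cnj d) \<le> sqrt (((cmod a)\<^sup>2 + (cmod c)\<^sup>2) * ((cmod b)\<^sup>2 + (cmod d)\<^sup>2))"
proof -
  have "cmod (a * cnj b + c * cnj d) \<le> cmod a * cmod b + cmod c * cmod d"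
    by (metis complex_mod_cnj norm_mult norm_triangle_ineq)
  also have "\<dots> \<le> sqrt (((cmod a)\<^sup>2 + (cmod c)\<^sup>2) * ((cmod b)\<^sup>2 + (cmod d)\<^sup>2))"
  proof (rule real_le_rsqrt)
    have "((cmod a)\<^sup>2 + (cmod c)\<^sup>2) * ((cmod b)\<^sup>2 + (cmod d)\<^sup>2) - (cmod a * cmod b + cmod c * cmod d)\<^sup>2
      = (cmod a * cmod d - cmod c * cmod b)\<^sup>2" by (simp add: power2_eq_square algebra_simps)
    then show "(cmod a * cmod b + cmod c * cmod d)\<^sup>2 \<le> ((cmod a)\<^sup>2 + (cmod c)\<^sup>2) * ((cmod b)\<^sup>2 + (cmod d)\<^sup>2)"
      by (smt (verit) zero_le_power2)
  qed
  finally show ?thesis .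
qed

lemma subconcurrence_csx_adjacent:
  fixes a c d f :: complex
  defines "x \<equiv> c / 2" and "y \<equiv> d / sqrt 2"
  shows "subconcurrence_dist 1 (csx a c d f) = 2 * max
    (cmod (a * cnj x + x * cnj f) - ((cmod x)\<^sup>2 + (cmod y)\<^sup>2))
    (cmod (y * cnj x + x * cnj y) - sqrt (((cmod a)\<^sup>2 + (cmod x)\<^sup>2) * ((cmod x)\<^sup>2 + (cmod f)\<^sup>2)))"
  unfolding subconcurrence_dist_def x_def y_def reduced_csx_adjacent
  using cmod_cauchy_schwarz[of a "c / 2" "c / 2" f] cmod_cauchy_schwarz[of "d / sqrt 2" "c / 2" "c / 2" "d / sqrt 2"]
  by (subst subconcurrence_x_matrix) (simp_all add: add.commute)

lemma subconcurrence_csx_opposite: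
  fixes a c d f :: complex
  defines "x \<equiv> c / 2" and "y \<equiv> d / sqrt 2"
  shows "subconcurrence_dist 2 (csx a c d f) = 2 * max
    (cmod (a * cnj y + y * cnj f) - 2 * (cmod x)\<^sup>2)
    (2 * (cmod x)\<^sup>2 - sqrt (((cmod a)\<^sup>2 + (cmod y)\<^sup>2) * ((cmod y)\<^sup>2 + (cmod f)\<^sup>2)))"
  unfolding subconcurrence_dist_def x_def y_def reduced_csx_opposite
  using cmod_cauchy_schwarz[of a "d / sqrt 2" "d / sqrt 2" f]
  by (subst subconcurrence_x_matrix)
    (simp_all only: norm_of_real real_sqrt_abs2, simp_all add: add.commute)

section \<open>Inequalities between the moduli\<close>

text \<open>Weak Lagrangian duality: \<open>g\<close> is the objective, \<open>n\<close> the
  normalisation form, \<open>u\<close> the constraint and \<open>\<mu>\<close> its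
  multiplier.\<close>

lemma multiplier_bound:
  fixes t n g \<mu> u :: real
  assumes "0 \<le> t * n - g - \<mu> * u" "n \<le> 1" "0 \<le> t" "0 \<le> \<mu>" "0 \<le> u"
  shows "g \<le> t"
  using assms mult_left_mono[of n 1 t] mult_nonneg_nonneg[of \<mu> u] by linarith

text \<open>
  Equality holds at $m = (2 + \sqrt 2)/(4\sqrt 2)$, $x = 1/4$, $y = x^2/m$; the kernel of the
  quadratic form at this point fixes the multiplier of $my - x^2$ to be 1.
\<close>
lemma core_bound:
  fixes m x y :: real
  assumes "2 * m\<^sup>2 + 4 * x\<^sup>2 + 2 * y\<^sup>2 \<le> 1" "x\<^sup>2 \<le> m * y"
  shows "2 * (2 * x * m - x\<^sup>2 - y\<^sup>2) \<le> (2 * sqrt 2 - 1) / 4"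
proof -
  define k where "k = sqrt (2::real)"
  have k: "k * k = 2" "k \<ge> 1" by (simp_all add: k_def)
  \<comment> \<open>The squares vanish at the equality point, where \<open>x / m = k - 1\<close> and
    \<open>y / m = (k - 1)\<^sup>2 = 3 - 2 * k\<close>. The two sides agree only modulo
    \<open>k * k = 2\<close>, so that factor is split off their difference.\<close>
  have "(2 * k - 1) / 4 * (2 * m\<^sup>2 + 4 * x\<^sup>2 + 2 * y\<^sup>2) - 2 * (2 * x * m - x\<^sup>2 - y\<^sup>2) - 1 * (m * y - x\<^sup>2)
      = (k + 3/2) * (y - (3 - 2 * k) * m)\<^sup>2 + (2 * k + 2) * (x - (k - 1) * m)\<^sup>2" (is "?L = ?R")
  proof -
    have "?R - ?L = (k * k - 2) * ((6 * k - 8) * m\<^sup>2 + 4 * (m * y) - 4 * (x * m))"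
      by (simp add: power2_eq_square field_simps)
    then show ?thesis using k(1) by simp
  qed
  also have "\<dots> \<ge> 0" using k(2) by simp
  finally have "2 * (2 * x * m - x\<^sup>2 - y\<^sup>2) \<le> (2 * k - 1) / 4"
    by (rule multiplier_bound) (use assms k(2) in auto)
  then show ?thesis by (simp add: k_def)
qed

text \<open>Cauchy-Schwarz for (A, x) with (F, x), and for (A, x) with (x, F).\<close>

lemma sqrt_prod_ge:
  fixes A F x :: real
  shows "A * F + x\<^sup>2 \<le> sqrt ((A\<^sup>2 + x\<^sup>2) * (x\<^sup>2 + F\<^sup>2))" "x * (A + F) \<le> sqrt ((A\<^sup>2 + x\<^sup>2) * (x\<^sup>2 + F\<^sup>2))"
proof -
  have "(A\<^sup>2 + x\<^sup>2) * (x\<^sup>2 + F\<^sup>2) = (A * F + x\<^sup>2)\<^sup>2 + (x * (A - F))\<^sup>2"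
    "(A\<^sup>2 + x\<^sup>2) * (x\<^sup>2 + F\<^sup>2) = (x * (A + F))\<^sup>2 + (A * F - x\<^sup>2)\<^sup>2"
    by (simp_all add: power2_eq_square algebra_simps)
  then have "(A * F + x\<^sup>2)\<^sup>2 \<le> (A\<^sup>2 + x\<^sup>2) * (x\<^sup>2 + F\<^sup>2)" "(x * (A + F))\<^sup>2 \<le> (A\<^sup>2 + x\<^sup>2) * (x\<^sup>2 + F\<^sup>2)"
    by (metis le_add_same_cancel1 zero_le_power2)+
  then show "A * F + x\<^sup>2 \<le> sqrt ((A\<^sup>2 + x\<^sup>2) * (x\<^sup>2 + F\<^sup>2))" "x * (A + F) \<le> sqrt ((A\<^sup>2 + x\<^sup>2) * (x\<^sup>2 + F\<^sup>2))"
    by (simp_all add: real_le_rsqrt)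
qed

text \<open>Each alternative in the hypothesis weakens to a quadratic constraint, (I) or (II); under
  each, both entries of the maximum in the conclusion are bounded. Replacing \<open>A\<close> and
  \<open>F\<close> by their mean \<open>m\<close> does not increase the normalisation form.\<close>

lemma adjacent_bound:
  fixes A F x y :: real
  assumes nn: "A \<ge> 0" "F \<ge> 0" "x \<ge> 0" "y \<ge> 0"
    and N: "A\<^sup>2 + F\<^sup>2 + 4 * x\<^sup>2 + 2 * y\<^sup>2 = 1"
    and opposite: "0 \<le> max (y * (A + F) - 2 * x\<^sup>2) (2 * x\<^sup>2 - sqrt ((A\<^sup>2 + y\<^sup>2) * (y\<^sup>2 + F\<^sup>2)))"
  shows "2 * max (x * (A + F) - (x\<^sup>2 + y\<^sup>2)) (2 * x * y - sqrt ((A\<^sup>2 + x\<^sup>2) * (x\<^sup>2 + F\<^sup>2)))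
    \<le> (2 * sqrt 2 - 1) / 4"
proof -
  let ?P = "sqrt ((A\<^sup>2 + x\<^sup>2) * (x\<^sup>2 + F\<^sup>2))"
  define m k where "m = (A + F) / 2" and "k = sqrt (2::real)"
  \<comment> \<open>The bound 7/6 is what makes \<open>(2 * k - 1) / 4\<close> at least 1/3.\<close>
  have k: "k * k = 2" "k \<ge> 7/6" by (simp add: k_def, unfold k_def, rule real_le_rsqrt, simp add: power2_eq_square)
  have m: "m \<ge> 0" "A + F = 2 * m" using nn by (simp_all add: m_def)
  have "A\<^sup>2 + F\<^sup>2 - 2 * m\<^sup>2 = (A - F)\<^sup>2 / 2" by (simp add: m_def power2_eq_square field_simps)
  then have "2 * m\<^sup>2 \<le> A\<^sup>2 + F\<^sup>2" by (smt (verit) divide_nonneg_nonneg zero_le_power2)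
  with N have N': "2 * m\<^sup>2 + 4 * x\<^sup>2 + 2 * y\<^sup>2 \<le> 1" by linarith
  from opposite consider (I) "x\<^sup>2 \<le> m * y" | (II) "A * F + y\<^sup>2 \<le> 2 * x\<^sup>2"
    using sqrt_prod_ge(1)[of A F y] m by (auto simp: max_def algebra_simps split: if_splits)
  then have "2 * (x * (A + F) - (x\<^sup>2 + y\<^sup>2)) \<le> (2 * k - 1) / 4 \<and> 2 * (2 * x * y - ?P) \<le> (2 * k - 1) / 4"
  proof cases
    case I
    have 1: "2 * (x * (A + F) - (x\<^sup>2 + y\<^sup>2)) \<le> (2 * k - 1) / 4"
      using core_bound[OF N' I] m by (simp add: k_def algebra_simps)
    have 2: "2 * (2 * x * y - ?P) \<le> (2 * k - 1) / 4"
    proof (cases "m \<le> x")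
      case True
      have AF: "m\<^sup>2 - A * F = ((A - F) / 2)\<^sup>2" by (simp add: m_def power2_eq_square field_simps)
      have "m\<^sup>2 \<le> x\<^sup>2" using True m by (simp add: power_mono)
      \<comment> \<open>Both factors are nonpositive because
        \<open>A * F \<le> m\<^sup>2 \<le> x\<^sup>2\<close>.\<close>
      then have "(A * F - m\<^sup>2) * (A * F + m\<^sup>2 - 2 * x\<^sup>2) \<ge> 0"
        using AF zero_le_power2[of "(A - F) / 2"] by (intro mult_nonpos_nonpos) linarith+
      moreover have "(A\<^sup>2 + x\<^sup>2) * (x\<^sup>2 + F\<^sup>2) - (x\<^sup>2 + m\<^sup>2)\<^sup>2 = (A * F - m\<^sup>2) * (A * F + m\<^sup>2 - 2 * x\<^sup>2)"
        by (simp add: m_def power2_eq_square field_simps)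
      ultimately have "x\<^sup>2 + m\<^sup>2 \<le> ?P" by (intro real_le_rsqrt) linarith
      \<comment> \<open>Normalisation and constraint are symmetric in \<open>m\<close> and
        \<open>y\<close>, so the core bound applies with these exchanged.\<close>
      then show ?thesis using core_bound[of y x m] N' I by (simp add: k_def algebra_simps)
    next
      case False
      then have "x * x \<le> x * m" "x\<^sup>2 \<le> m\<^sup>2" using nn by (auto intro: mult_left_mono power_mono)
      \<comment> \<open>As \<open>?P \<ge> 2 * x * m \<ge> 2 * x\<^sup>2\<close>, the goal's left
        side is at most \<open>2 * x\<^sup>2 + 2 / 3 * y\<^sup>2\<close>, a third of
        \<open>6 * x\<^sup>2 + 2 * y\<^sup>2 \<le> 1\<close>.\<close>
      moreover have "6 * x\<^sup>2 + 2 / 3 * y\<^sup>2 - 4 * x * y = 6 * (x - y / 3)\<^sup>2"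
        by (simp add: power2_eq_square field_simps)
      moreover have "2 * x * m \<le> ?P" using sqrt_prod_ge(2)[of x A F] m by simp
      moreover have "0 \<le> 6 * (x - y / 3)\<^sup>2" by simp
      ultimately show ?thesis using N' k(2) unfolding power2_eq_square by (simp add: algebra_simps)
    qed
    from 1 2 show ?thesis ..
  next
    case II
    \<comment> \<open>The squares vanish at \<open>A = F\<close>,
      \<open>x = k / 4 * (A + F)\<close>, \<open>y = 0\<close>, the extremal state.\<close>
    have "(2 * k - 1) / 4 * (A\<^sup>2 + F\<^sup>2 + 4 * x\<^sup>2 + 2 * y\<^sup>2) - 2 * (x * (A + F) - (x\<^sup>2 + y\<^sup>2)) - 1 / 2 * (2 * x\<^sup>2 - (A * F + y\<^sup>2))
       = 2 * k * (x - k / 4 * (A + F))\<^sup>2 + (k - 1) / 4 * (A - F)\<^sup>2 + (k + 2) * y\<^sup>2" (is "?L = ?R")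
    proof -
      have "?R - ?L = (k * k - 2) * (k / 8 * (A + F)\<^sup>2 - x * (A + F))"
        by (simp add: power2_eq_square field_simps)
      then show ?thesis using k(1) by simp
    qed
    also have "\<dots> \<ge> 0" using k(2) by (intro add_nonneg_nonneg mult_nonneg_nonneg) auto
    finally have 1: "2 * (x * (A + F) - (x\<^sup>2 + y\<^sup>2)) \<le> (2 * k - 1) / 4"
      by (rule multiplier_bound) (use II N k(2) in auto)
    \<comment> \<open>This form vanishes at \<open>A = F = 0\<close>, \<open>y = k * x\<close>,
      where the bound is sharp as well.\<close>
    have "(2 * k - 1) / 4 * (A\<^sup>2 + F\<^sup>2 + 4 * x\<^sup>2 + 2 * y\<^sup>2) - 2 * (2 * x * y - (A * F + x\<^sup>2)) - 1 / 2 * (2 * x\<^sup>2 - (A * F + y\<^sup>2))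
       = k * (y - k * x)\<^sup>2 + (2 * k - 1) / 4 * (A\<^sup>2 + F\<^sup>2) + 5 / 2 * (A * F)" (is "?L = ?R")
    proof -
      have "?R - ?L = (k * k - 2) * (k * x\<^sup>2 - 2 * x * y)"
        by (simp add: power2_eq_square field_simps)
      then show ?thesis using k(1) by simp
    qed
    also have "\<dots> \<ge> 0" using k(2) nn by (intro add_nonneg_nonneg mult_nonneg_nonneg) auto
    finally have "2 * (2 * x * y - (A * F + x\<^sup>2)) \<le> (2 * k - 1) / 4"
      by (rule multiplier_bound) (use II N k(2) in auto)
    moreover have "2 * (2 * x * y - ?P) \<le> 2 * (2 * x * y - (A * F + x\<^sup>2))"
      using sqrt_prod_ge(1)[of A F x] by simp
    ultimately have 2: "2 * (2 * x * y - ?P) \<le> (2 * k - 1) / 4" by (rule order.trans[rotated])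
    from 1 2 show ?thesis ..
  qed
  then show ?thesis by (simp add: k_def max_def)
qed

text \<open>The hypothesis again weakens to (I) or (II). Only the bound on
  \<open>2 * x\<^sup>2 - ?P\<close> under (I) is sharp; the other three leave slack.\<close>

lemma opposite_bound:
  fixes A F x y :: real
  assumes nn: "A \<ge> 0" "F \<ge> 0" "x \<ge> 0" "y \<ge> 0"
    and N: "A\<^sup>2 + F\<^sup>2 + 4 * x\<^sup>2 + 2 * y\<^sup>2 = 1"
    and adjacent: "0 \<le> max (x * (A + F) - (x\<^sup>2 + y\<^sup>2)) (2 * x * y - sqrt ((A\<^sup>2 + x\<^sup>2) * (x\<^sup>2 + F\<^sup>2)))"
  shows "2 * max (y * (A + F) - 2 * x\<^sup>2) (2 * x\<^sup>2 - sqrt ((A\<^sup>2 + y\<^sup>2) * (y\<^sup>2 + F\<^sup>2))) \<le> 4 / 5"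
proof -
  let ?P = "sqrt ((A\<^sup>2 + y\<^sup>2) * (y\<^sup>2 + F\<^sup>2))"
  have AF: "A * F \<ge> 0" using nn by simp
  have P: "A * F + y\<^sup>2 \<le> ?P" by (rule sqrt_prod_ge)
  from adjacent consider (I) "x\<^sup>2 + y\<^sup>2 \<le> x * (A + F)" | (II) "A * F + x\<^sup>2 \<le> 2 * x * y"
    using sqrt_prod_ge(1)[of A F x] by (auto simp: max_def split: if_splits)
  then have "2 * (y * (A + F) - 2 * x\<^sup>2) \<le> 4 / 5 \<and> 2 * (2 * x\<^sup>2 - ?P) \<le> 4 / 5"
  proof cases
    case I
    \<comment> \<open>With multiplier 9/5 the form is positive definite: the last coefficient is
      27/1700.\<close>
    have "4 / 5 * (A\<^sup>2 + F\<^sup>2 + 4 * x\<^sup>2 + 2 * y\<^sup>2) - 2 * (y * (A + F) - 2 * x\<^sup>2) - 9 / 5 * (x * (A + F) - (x\<^sup>2 + y\<^sup>2))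
      = 17 / 5 * (y - 5 / 17 * (A + F))\<^sup>2 + 9 * (x - (A + F) / 10)\<^sup>2 + 2 / 5 * (A - F)\<^sup>2
        + (31 / 100 - 5 / 17) * (A + F)\<^sup>2"
      by (simp add: power2_eq_square field_simps)
    also have "\<dots> \<ge> 0" by simp
    finally have 1: "2 * (y * (A + F) - 2 * x\<^sup>2) \<le> 4 / 5"
      by (rule multiplier_bound) (use I N in auto)
    \<comment> \<open>Dividing the constraint by \<open>x\<close> suffices for the sharp bound;
      equality needs \<open>x = A + F\<close>, \<open>A * F = 0\<close> and
      \<open>y = 0\<close>.\<close>
    have "x \<le> A + F"
    proof (cases "x = 0")
      case False
      have "x * x \<le> x * (A + F)" using I zero_le_power2[of y] unfolding power2_eq_square by linarith
      with False nn show ?thesis by simp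
    qed (use nn in simp)
    then have "x\<^sup>2 \<le> (A + F)\<^sup>2" using nn by (intro power_mono)
    then have "x\<^sup>2 \<le> A\<^sup>2 + F\<^sup>2 + 2 * (A * F)" by (simp add: power2_sum)
    with N AF zero_le_power2[of y] have "2 * (2 * x\<^sup>2 - (A * F + y\<^sup>2)) \<le> 4 / 5"
      by argo
    with P have 2: "2 * (2 * x\<^sup>2 - ?P) \<le> 4 / 5" by argo
    from 1 2 show ?thesis ..
  next
    case II
    have "4 / 5 * (A\<^sup>2 + F\<^sup>2 + 4 * x\<^sup>2 + 2 * y\<^sup>2) - 2 * (y * (A + F) - 2 * x\<^sup>2) - 8 / 5 * (2 * x * y - (A * F + x\<^sup>2))
      = 4 / 5 * (A + F - 5 / 4 * y)\<^sup>2 + 44 / 5 * (x - 2 / 11 * y)\<^sup>2 + (7 / 20 - 16 / 55) * y\<^sup>2"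
      by (simp add: power2_eq_square field_simps)
    also have "\<dots> \<ge> 0" by simp
    finally have 1: "2 * (y * (A + F) - 2 * x\<^sup>2) \<le> 4 / 5"
      by (rule multiplier_bound) (use II N in auto)
    \<comment> \<open>After normalisation the goal only needs
      \<open>4 / 5 * x\<^sup>2 \<le> 18 / 5 * y\<^sup>2\<close>.\<close>
    have "x \<le> 2 * y"
    proof (cases "x = 0")
      case False
      have "x * x \<le> x * (2 * y)" using II AF unfolding power2_eq_square by linarith
      with False nn show ?thesis by simp
    qed (use nn in simp)
    then have "x\<^sup>2 \<le> (2 * y)\<^sup>2" using nn by (intro power_mono)
    then have "x\<^sup>2 \<le> 4 * y\<^sup>2" by simp
    with N AF zero_le_power2[of y] zero_le_power2[of A] zero_le_power2[of F]
    have "2 * (2 * x\<^sup>2 - (A * F + y\<^sup>2)) \<le> 4 / 5" by argo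
    with P have 2: "2 * (2 * x\<^sup>2 - ?P) \<le> 4 / 5" by argo
    from 1 2 show ?thesis ..
  qed
  then show ?thesis by (simp add: max_def)
qed

section \<open>Removal of the phases and the two thresholds\<close>

text \<open>Phases enter only through off-diagonal moduli, which occur with positive sign. Upper
  bounds on both quantities suffice: one carries over the nonnegativity hypothesis, the other the
  conclusion.\<close>

lemma subconcurrence_csx_le:
  fixes a c d f :: complex
  defines "A \<equiv> cmod a" and "F \<equiv> cmod f" and "x \<equiv> cmod c / 2" and "y \<equiv> cmod d / sqrt 2"
  shows "subconcurrence_dist 1 (csx a c d f) \<le>
      2 * max (x * (A + F) - (x\<^sup>2 + y\<^sup>2)) (2 * x * y - sqrt ((A\<^sup>2 + x\<^sup>2) * (x\<^sup>2 + F\<^sup>2)))"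
    and "subconcurrence_dist 2 (csx a c d f) \<le>
      2 * max (y * (A + F) - 2 * x\<^sup>2) (2 * x\<^sup>2 - sqrt ((A\<^sup>2 + y\<^sup>2) * (y\<^sup>2 + F\<^sup>2)))"
proof -
  have tri: "cmod (u * cnj v + v * cnj w) \<le> cmod v * (cmod u + cmod w)" for u v w
    using norm_triangle_ineq[of "u * cnj v" "v * cnj w"] by (simp add: norm_mult algebra_simps)
  have xy: "cmod (c / 2) = x" "cmod (d / sqrt 2) = y"
    by (simp_all add: x_def y_def norm_divide)
  show "subconcurrence_dist 1 (csx a c d f) \<le>
      2 * max (x * (A + F) - (x\<^sup>2 + y\<^sup>2)) (2 * x * y - sqrt ((A\<^sup>2 + x\<^sup>2) * (x\<^sup>2 + F\<^sup>2)))"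
    using tri[of a "c / 2" f] tri[of "d / sqrt 2" "c / 2" "d / sqrt 2"]
    unfolding subconcurrence_csx_adjacent xy A_def[symmetric] F_def[symmetric]
    by (intro mult_left_mono max.mono) simp_all
  show "subconcurrence_dist 2 (csx a c d f) \<le>
      2 * max (y * (A + F) - 2 * x\<^sup>2) (2 * x\<^sup>2 - sqrt ((A\<^sup>2 + y\<^sup>2) * (y\<^sup>2 + F\<^sup>2)))"
    using tri[of a "d / sqrt 2" f]
    unfolding subconcurrence_csx_opposite xy A_def[symmetric] F_def[symmetric]
    by (intro mult_left_mono max.mono) simp_all
qed

text \<open>The witness \<open>\<psi>0\<close> refutes every candidate below \<open>\<tau>\<close>,
  which gives minimality.\<close>

lemma is_thresholdI:
  assumes "\<And>\<psi>. \<psi> \<in> S \<Longrightarrow> 0 \<le> G \<psi> \<Longrightarrow> F \<psi> \<le> \<tau>"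
    and "\<psi>0 \<in> S" "F \<psi>0 = \<tau>" "0 \<le> G \<psi>0"
  shows "is_threshold S F G \<tau>"
  using assms unfolding is_threshold_def by (metis linorder_not_le)

theorem mainTheorem5:
  shows "let CSX = {a *s ket (bits 0 0 0 0) + c *s cyclic_ket (bits 0 0 1 1)
                      + d *s cyclic_ket (bits 0 1 0 1) + f *s ket (bits 1 1 1 1) | a c d f.
                    (cmod a)\<^sup>2 + (cmod c)\<^sup>2 + (cmod d)\<^sup>2 + (cmod f)\<^sup>2 = 1}
         in is_threshold CSX (subconcurrence_dist 1) (subconcurrence_dist 2) ((2 * sqrt 2 - 1) / 4) \<and>
            is_threshold CSX (subconcurrence_dist 2) (subconcurrence_dist 1) (4 / 5)"
proof -
  define CSX where "CSX = {csx a c d f | a c d f. (cmod a)\<^sup>2 + (cmod c)\<^sup>2 + (cmod d)\<^sup>2 + (cmod f)\<^sup>2 = 1}"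
  have N: "(cmod a)\<^sup>2 + (cmod f)\<^sup>2 + 4 * (cmod c / 2)\<^sup>2 + 2 * (cmod d / sqrt 2)\<^sup>2 = 1"
    if "(cmod a)\<^sup>2 + (cmod c)\<^sup>2 + (cmod d)\<^sup>2 + (cmod f)\<^sup>2 = 1" for a c d f
    using that by (simp add: power_divide)
  have 1: "is_threshold CSX (subconcurrence_dist 1) (subconcurrence_dist 2) ((2 * sqrt 2 - 1) / 4)"
  proof (rule is_thresholdI)
    fix \<psi> assume "\<psi> \<in> CSX" and nonneg: "0 \<le> subconcurrence_dist 2 \<psi>"
    then obtain a c d f where \<psi>: "\<psi> = csx a c d f" and
      norm: "(cmod a)\<^sup>2 + (cmod c)\<^sup>2 + (cmod d)\<^sup>2 + (cmod f)\<^sup>2 = 1"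
      unfolding CSX_def by blast
    note bounds = subconcurrence_csx_le[of a c d f]
    show "subconcurrence_dist 1 \<psi> \<le> (2 * sqrt 2 - 1) / 4"
      unfolding \<psi> using nonneg bounds(2)
      by (intro order.trans[OF bounds(1)] adjacent_bound N[OF norm]) (simp_all add: \<psi>)
  next
    \<comment> \<open>The equality case of \<open>adjacent_bound\<close> with
      \<open>A = F = 1 / 2\<close>, \<open>x = sqrt 2 / 4\<close>, so
      \<open>c = 2 * x = 1 / sqrt 2\<close>.\<close>
    let ?\<psi> = "csx (1 / 2) (1 / sqrt 2) 0 (1 / 2)"
    show "?\<psi> \<in> CSX"
      unfolding CSX_def by (force simp: norm_divide power_divide)
    have q: "sqrt (1 / 16) = 1 / 4" by (rule real_sqrt_unique) (simp_all add: power2_eq_square)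
    have s: "\<not> 32 \<le> - (sqrt 2 * 16)" by (smt (verit) real_sqrt_ge_zero)
    show "subconcurrence_dist 1 ?\<psi> = (2 * sqrt 2 - 1) / 4"
      unfolding subconcurrence_csx_adjacent
      using s by (simp add: norm_divide norm_mult power_divide real_sqrt_divide max_def field_simps)
    show "0 \<le> subconcurrence_dist 2 ?\<psi>"
      unfolding subconcurrence_csx_opposite
      by (simp add: norm_divide norm_mult power_divide q)
  qed
  have 2: "is_threshold CSX (subconcurrence_dist 2) (subconcurrence_dist 1) (4 / 5)"
  proof (rule is_thresholdI)
    fix \<psi> assume "\<psi> \<in> CSX" and nonneg: "0 \<le> subconcurrence_dist 1 \<psi>"
    then obtain a c d f where \<psi>: "\<psi> = csx a c d f" and
      norm: "(cmod a)\<^sup>2 + (cmod c)\<^sup>2 + (cmod d)\<^sup>2 + (cmod f)\<^sup>2 = 1"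
      unfolding CSX_def by blast
    note bounds = subconcurrence_csx_le[of a c d f]
    show "subconcurrence_dist 2 \<psi> \<le> 4 / 5"
      unfolding \<psi> using nonneg bounds(1)
      by (intro order.trans[OF bounds(2)] opposite_bound N[OF norm]) (simp_all add: \<psi>)
  next
    \<comment> \<open>The equality case of \<open>opposite_bound\<close> with
      \<open>F = y = 0\<close>: \<open>x = A = 1 / sqrt 5\<close>, so
      \<open>c = 2 * x\<close>.\<close>
    let ?\<psi> = "csx (1 / sqrt 5) (2 / sqrt 5) 0 0"
    show "?\<psi> \<in> CSX"
      unfolding CSX_def by (force simp: norm_divide power_divide)
    show "subconcurrence_dist 2 ?\<psi> = 4 / 5"
      unfolding subconcurrence_csx_opposite by (simp add: norm_divide power_divide)
    show "0 \<le> subconcurrence_dist 1 ?\<psi>"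
      unfolding subconcurrence_csx_adjacent
      by (simp add: norm_divide norm_mult power_divide le_max_iff_disj)
  qed
  from 1 2 show ?thesis
    unfolding CSX_def csx_def Let_def ..
qed

end
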